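(* Let $X=\{\Phi_{p_1,\theta_1}>0\}\cap\cdots\cap\{\Phi_{p_k,\theta_k}>0\}$ be the intersection of finitely many pairwise distinct open polynomial half planes. Then $X$ is a disjoint union of finitely many regions of type II.
   Context: For a real polynomial $p$ and angle $\theta$, $\Phi_{p,\theta}(x,y)=p(x\cos\theta+y\sin\theta)-(-x\sin\theta+y\cos\theta)$; $\{\Phi_{p,\theta}>0\}$ is an open polynomial half plane and $\{\Phi_{p,\theta}=0\}$ a rotated polynomial graph. A region of type I is a closed, connected, simply connected subset of $\mathbb{R}^2$ which is the closure of its interior and whose boundary is the union of finitely many arcs (sides), each contained in a rotated polynomial graph. A region of type II is the interior of a region of type I. *)

theory Defs
  imports "HOL-Analysis.Analysis" "HOL-Computational_Algebra.Polynomial"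
begin

definition Phi :: "real poly \<Rightarrow> real \<Rightarrow> real \<times> real \<Rightarrow> real" where
  "Phi p \<theta> z = poly p (fst z * cos \<theta> + snd z * sin \<theta>) - (- fst z * sin \<theta> + snd z * cos \<theta>)"

definition poly_half_plane :: "real poly \<Rightarrow> real \<Rightarrow> (real \<times> real) set" where
  "poly_half_plane p \<theta> = {z. Phi p \<theta> z > 0}"

definition rot_poly_graph :: "real poly \<Rightarrow> real \<Rightarrow> (real \<times> real) set" where
  "rot_poly_graph p \<theta> = {z. Phi p \<theta> z = 0}"

text \<open>An arc: a homeomorphic image of a non-degenerate real interval
  (possibly unbounded or non-closed, so that whole polynomial graphs count).\<close>
definition is_arc :: "(real \<times> real) set \<Rightarrow> bool" where
  "is_arc A \<longleftrightarrow> (\<exists>I :: real set. is_interval I \<and> (\<exists>a b. a \<in> I \<and> b \<in> I \<and> a \<noteq> b)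
                      \<and> I homeomorphic A)"

definition region_typeI :: "(real \<times> real) set \<Rightarrow> bool" where
  "region_typeI R \<longleftrightarrow> closed R \<and> connected R \<and> simply_connected R
     \<and> closure (interior R) = R
     \<and> (\<exists>S. finite S \<and> frontier R = \<Union>S
            \<and> (\<forall>A\<in>S. is_arc A \<and> (\<exists>p \<theta>. A \<subseteq> rot_poly_graph p \<theta>)))"

definition region_typeII :: "(real \<times> real) set \<Rightarrow> bool" where
  "region_typeII U \<longleftrightarrow> (\<exists>R. region_typeI R \<and> U = interior R)"

end

theory Submission
  imports Defs "HOL-Complex_Analysis.Riemann_Mapping"
begin

text \<open>
  The regions are the components U of X. A polynomial
  homeomorphism maps each half plane to the upper half plane, and two different graphs meet in
  finitely many points because one function restricted to the other graph is a polynomial. At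
  a frontier point lying on only one graph, X is locally a half disc; hence each piece of a graph
  between crossings borders at most one component, X has finitely many components, and the
  frontier of U is a finite union of closed arcs which pairwise meet in finite sets.

  Such a frontier is an ANR, and so is the closure R of U, since R and the complement of U are
  closed with union the plane and intersection the frontier. All components of the complement of R
  are unbounded. Every loop in R therefore lies in a simply connected open subset of a
  neighbourhood that retracts onto R, so R is simply connected.
\<close>

section \<open>Simple connectedness of closed ANRs in the plane\<close>

text \<open>The complex-plane criterion \<open>simply_connected_iff_simple\<close> is carried over
  along the norm-preserving homeomorphism \<open>c\<close>.\<close>

lemma simply_connected_bounded_open_plane:
  fixes M :: "(real \<times> real) set"
  assumes "open M" "bounded M" "connected M" "connected (- M)"
  shows "simply_connected M"
proof -
  define c :: "real \<times> real \<Rightarrow> complex" where "c = (\<lambda>w. Complex (fst w) (snd w))"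
  define d :: "complex \<Rightarrow> real \<times> real" where "d = (\<lambda>z. (Re z, Im z))"
  have cd: "c (d z) = z" and dc: "d (c w) = w" for z w
    by (simp_all add: c_def d_def)
  have contc: "continuous_on S c" for S
    unfolding c_def by (intro continuous_intros)
  have contd: "continuous_on S d" for S
    unfolding d_def by (intro continuous_intros)
  have img: "c ` A = d -` A" for A
    using cd dc by (auto simp: image_iff) metis
  have "open (c ` M)"
    unfolding img using assms(1) contd open_vimage by blast
  moreover have "bounded (c ` M)"
  proof -
    have "norm (c w) = norm w" for w
      by (cases w) (simp add: c_def norm_Pair cmod_def)
    then show ?thesis
      using assms(2) by (simp add: bounded_iff)
  qed
  moreover have "connected (c ` M)"
    using connected_continuous_image contc assms(3) by blast
  moreover have "- c ` M = c ` (- M)"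
    unfolding img by auto
  then have "connected (- c ` M)"
    using connected_continuous_image contc assms(4) by metis
  ultimately have "simply_connected (c ` M)"
    by (simp add: simply_connected_iff_simple)
  moreover have "homeomorphism M (c ` M) c d"
    unfolding homeomorphism_def using contc contd cd dc by (auto simp: image_image)
  ultimately show ?thesis
    using homeomorphic_def homeomorphic_simply_connected_eq by blast
qed

text \<open>Each point of the closed ball outside \<open>N\<close> can be joined to the exterior of
  the ball without touching \<open>R\<close>, because complementary components are unbounded. By
  compactness finitely many such connectors suffice; with the exterior they form a closed connected
  set \<open>S\<close>, and components of \<open>- S\<close> have no holes.\<close>

lemma simply_connected_open_nbhd_between:
  fixes R :: "(real \<times> real) set"
  assumes "closed R" and unb: "\<And>C. C \<in> components (- R) \<Longrightarrow> \<not> bounded C"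
    and "open N" "R \<subseteq> N" and K: "compact K" "connected K" "K \<subseteq> R" "K \<noteq> {}"
  obtains M where "simply_connected M" "K \<subseteq> M" "M \<subseteq> N"
proof -
  obtain r where r: "K \<subseteq> ball 0 r"
    using K(1) by (metis bounded_subset_ballD compact_imp_bounded)
  define F where "F = cball 0 r - N"
  have "compact F"
    unfolding F_def using \<open>open N\<close> by (simp add: compact_diff)
  have "\<exists>D. compact D \<and> connected D \<and> D \<inter> R = {} \<and> D \<inter> - ball 0 r \<noteq> {} \<and> x \<in> interior D"
    if "x \<in> F" for x
  proof -
    have xR: "x \<in> - R"
      using that \<open>R \<subseteq> N\<close> by (auto simp: F_def)
    define W where "W = connected_component_set (- R) x"
    have W: "W \<in> components (- R)" "x \<in> W" "W \<subseteq> - R"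
      using xR by (auto simp: W_def componentsI connected_component_subset)
    have "open W"
      using W(1) \<open>closed R\<close> open_components by blast
    moreover have "connected W"
      using W(1) in_components_connected by blast
    ultimately have pc: "path_connected W"
      using connected_open_path_connected by blast
    have "\<not> bounded W"
      using unb W(1) by blast
    then obtain y where y: "y \<in> W" "y \<notin> ball 0 r"
      by (meson bounded_ball bounded_subset subsetI)
    obtain q where q: "path q" "path_image q \<subseteq> W" "pathstart q = x" "pathfinish q = y"
      using pc W(2) y(1) unfolding path_connected_def by blast
    \<comment> \<open>The disc is added to the path so that \<open>x\<close> is interior to the
      connector, as the finite subcover requires.\<close>
    obtain e where e: "e > 0" "cball x e \<subseteq> W"
      using \<open>open W\<close> W(2) open_contains_cball by blast
    show ?thesis
    proof (intro exI conjI)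
      show "compact (cball x e \<union> path_image q)"
        using q(1) by (simp add: compact_Un compact_path_image)
      show "connected (cball x e \<union> path_image q)"
      proof (rule connected_Un)
        have "x \<in> cball x e \<inter> path_image q"
          using e(1) q(3) pathstart_in_path_image[of q] by simp
        then show "cball x e \<inter> path_image q \<noteq> {}"
          by blast
      qed (use q(1) in \<open>auto simp: connected_path_image\<close>)
      show "(cball x e \<union> path_image q) \<inter> R = {}"
        using e(2) q(2) W(3) by blast
      show "(cball x e \<union> path_image q) \<inter> - ball 0 r \<noteq> {}"
        using y(2) q(4) pathfinish_in_path_image by blast
      show "x \<in> interior (cball x e \<union> path_image q)"
        using e(1) by (meson centre_in_ball interior_maximal open_ball ball_subset_cball le_supI1 subsetD)
    qed
  qed
  then obtain D where D: "\<And>x. x \<in> F \<Longrightarrow> compact (D x) \<and> connected (D x) \<and> D x \<inter> R = {}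
      \<and> D x \<inter> - ball 0 r \<noteq> {} \<and> x \<in> interior (D x)"
    by metis
  obtain T where T: "T \<subseteq> F" "finite T" "F \<subseteq> (\<Union>x\<in>T. interior (D x))"
  proof (rule compactE_image[OF \<open>compact F\<close>])
    show "F \<subseteq> (\<Union>x\<in>F. interior (D x))"
      using D by blast
  qed auto
  define S where "S = - ball 0 r \<union> (\<Union>x\<in>T. D x)"
  have conS: "connected S"
  proof -
    have b: "connected (- ball (0::real \<times> real) r)"
      by (intro connected_complement_bounded_convex) auto
    have "connected (- ball 0 r \<union> (\<Union>x\<in>T'. D x))" if "T' \<subseteq> T" for T'
      using finite_subset[OF that T(2)] that
    proof (induction T')
      case (insert x T')
      have "connected (D x \<union> (- ball 0 r \<union> (\<Union>x\<in>T'. D x)))"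
      proof (rule connected_Un)
        show "connected (D x)" "D x \<inter> (- ball 0 r \<union> (\<Union>x\<in>T'. D x)) \<noteq> {}"
          using insert.prems D[of x] T(1) by blast+
        show "connected (- ball 0 r \<union> (\<Union>x\<in>T'. D x))"
          using insert by blast
      qed
      then show ?case
        by (simp add: Un_left_commute)
    qed (simp add: b)
    then show ?thesis
      by (simp add: S_def)
  qed
  have "closed S"
    unfolding S_def
  proof (intro closed_Un closed_UN ballI)
    show "closed (D x)" if "x \<in> T" for x
      using that T(1) D compact_imp_closed by blast
  qed (use T(2) in auto)
  have "K \<subseteq> - S"
    using r D T(1) K(3) by (fastforce simp: S_def)
  then obtain M where M: "M \<in> components (- S)" "K \<subseteq> M"
    using exists_component_superset[of K "- S"] K(2,4) by auto
  have MS: "M \<subseteq> - S"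
    using M(1) in_components_subset by blast
  show ?thesis
  proof
    show "simply_connected M"
    proof (rule simply_connected_bounded_open_plane)
      show "open M"
        using M(1) \<open>closed S\<close> open_components by blast
      show "bounded M"
        using MS by (intro bounded_subset[OF bounded_ball[of 0 r]]) (auto simp: S_def)
      \<comment> \<open>The complement of a component of \<open>- S\<close> is connected because
        \<open>S\<close> is.\<close>
      show "connected M" "connected (- M)"
        using M(1) conS component_complement_connected in_components_connected by blast+
    qed
    show "M \<subseteq> N"
    proof
      fix x assume "x \<in> M"
      then have "x \<in> ball 0 r" "\<And>y. y \<in> T \<Longrightarrow> x \<notin> D y"
        using MS by (auto simp: S_def)
      moreover from this have "x \<notin> F"
        using T(3) interior_subset by blast
      ultimately show "x \<in> N"
        by (auto simp: F_def)
    qed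
  qed (rule M(2))
qed

text \<open>Some open \<open>N\<close> retracts onto \<open>R\<close>. A loop in \<open>R\<close>
  contracts inside a simply connected \<open>M\<close> between its image and \<open>N\<close>, and
  the retraction pushes this contraction back into \<open>R\<close>.\<close>

lemma simply_connected_closed_ANR_plane:
  fixes R :: "(real \<times> real) set"
  assumes "closed R" "connected R" "ANR R"
    and unb: "\<And>C. C \<in> components (- R) \<Longrightarrow> \<not> bounded C"
  shows "simply_connected R"
  unfolding simply_connected_eq_contractible_loop_some
proof (intro conjI allI impI)
  show "path_connected R"
    using assms ANR_imp_locally_path_connected path_component_eq_connected_component
    by (metis connected_iff_connected_component path_connected_component)
next
  fix p :: "real \<Rightarrow> real \<times> real"
  assume p: "path p \<and> path_image p \<subseteq> R \<and> pathfinish p = pathstart p"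
  obtain N where N: "open N" "R retract_of N"
    using ANR_imp_absolute_neighbourhood_retract_UNIV[OF \<open>ANR R\<close> homeomorphic_refl \<open>closed R\<close>] .
  obtain r where "retraction N R r"
    using N(2) by (auto simp: retract_of_def)
  then have r: "R \<subseteq> N" "continuous_on N r" "r \<in> N \<rightarrow> R" "\<And>x. x \<in> R \<Longrightarrow> r x = x"
    by (auto simp: retraction_def)
  obtain M where M: "simply_connected M" "path_image p \<subseteq> M" "M \<subseteq> N"
    using simply_connected_open_nbhd_between[OF \<open>closed R\<close> unb N(1) r(1), of "path_image p"] p
    by (metis compact_path_image connected_path_image path_image_nonempty)
  define a where "a = pathstart p"
  have a: "a \<in> R" "a \<in> M"
    using p M(2) by (auto simp: a_def)
  have "homotopic_loops M p (linepath a a)"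
    using M(1,2) p a unfolding simply_connected_eq_contractible_loop_any by blast
  then have h: "homotopic_loops R (r \<circ> p) (r \<circ> linepath a a)"
    using r(2,3) M(3) by (intro homotopic_loops_continuous_image[of M]) (auto intro: continuous_on_subset)
  have eq: "homotopic_loops R p (r \<circ> p)"
  proof (rule homotopic_loops_eq)
    fix t :: real assume "t \<in> {0..1}"
    then have "p t \<in> R"
      using p by (auto simp: path_image_def)
    then show "p t = (r \<circ> p) t"
      by (simp add: r(4))
  qed (use p in auto)
  have "r \<circ> linepath a a = linepath a a"
    using r(4) a(1) by (auto simp: linepath_def)
  then show "\<exists>a. a \<in> R \<and> homotopic_loops R p (linepath a a)"
    using a h eq homotopic_loops_trans by metis
qed

section \<open>Gluing ANRs, and cutting the line at finitely many points\<close>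

text \<open>Induction with \<open>ANR_closed_Un\<close>: the added set meets the union of the others
  in a finite set, which is itself an ANR.\<close>

lemma ANR_finite_Union_finite_Int:
  fixes \<A> :: "'a::euclidean_space set set"
  assumes "finite \<A>" "\<And>A. A \<in> \<A> \<Longrightarrow> closed A \<and> ANR A"
    and "\<And>A B. \<lbrakk>A \<in> \<A>; B \<in> \<A>; A \<noteq> B\<rbrakk> \<Longrightarrow> finite (A \<inter> B)"
  shows "ANR (\<Union>\<A>)"
  using assms
proof (induction \<A>)
  case (insert A \<A>)
  have "A \<inter> \<Union>\<A> = (\<Union>B\<in>\<A>. A \<inter> B)"
    by blast
  moreover have "finite (A \<inter> B)" if "B \<in> \<A>" for B
    using insert that by (metis insertCI)
  ultimately have "finite (A \<inter> \<Union>\<A>)"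
    using insert.hyps(1) finite_UN_I by metis
  then have "ANR (A \<union> \<Union>\<A>)"
    using insert by (intro ANR_closed_Un closed_Union finite_imp_ANR[of "A \<inter> \<Union>\<A>"]) auto
  then show ?case
    by simp
qed simp

text \<open>A component is an interval, determined by the points of \<open>T\<close> to its left; so
  \<open>key\<close> embeds the components into the finite power set of \<open>T\<close>.\<close>

lemma finite_components_Compl_finite_real:
  fixes T :: "real set"
  assumes "finite T"
  shows "finite (components (- T))"
proof -
  define key where "key = (\<lambda>C. {v\<in>T. \<exists>x\<in>C. v < x})"
  have key: "v < x" if "C \<in> components (- T)" "v \<in> T" "y \<in> C" "v < y" "x \<in> C" for C v x y
  proof (rule ccontr)
    assume "\<not> v < x"
    moreover have "is_interval C"
      using that(1) in_components_connected is_interval_connected_1 by blast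
    ultimately have "v \<in> C"
      using that by (meson is_interval_1 less_imp_le not_less)
    then show False
      using that in_components_subset by blast
  qed
  have sub: "C = D" if C: "C \<in> components (- T)" and D: "D \<in> components (- T)" and eq: "key C = key D"
      and x: "x \<in> C" and y: "y \<in> D" and "x \<le> y" for C D x y
  proof -
    have "v \<notin> {x..y}" if v: "v \<in> T" for v
    proof
      assume vxy: "v \<in> {x..y}"
      have "x \<notin> T" "y \<notin> T"
        using C D x y in_components_subset by blast+
      then have "x < v" "v < y"
        using v vxy by (auto simp: order.order_iff_strict)
      then have "v \<in> key C"
        unfolding eq using v y \<open>v < y\<close> by (auto simp: key_def)
      then show False
        using key[OF C v _ _ x] \<open>x < v\<close> by (auto simp: key_def)
    qed
    then have "{x..y} \<subseteq> - T"
      by blast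
    then have "{x..y} \<subseteq> C"
      using x \<open>x \<le> y\<close> by (intro components_maximal[OF C]) auto
    then show ?thesis
      using C D y \<open>x \<le> y\<close> components_eq[OF C D] by auto
  qed
  have "inj_on key (components (- T))"
  proof (rule inj_onI)
    fix C D assume CD: "C \<in> components (- T)" "D \<in> components (- T)" "key C = key D"
    obtain x y where "x \<in> C" "y \<in> D"
      using CD in_components_nonempty by fastforce
    then show "C = D"
      using sub CD by (metis linear)
  qed
  moreover have "key ` components (- T) \<subseteq> Pow T"
    by (auto simp: key_def)
  ultimately show ?thesis
    using assms by (meson finite_Pow_iff inj_on_finite)
qed

section \<open>Curves straightened by homeomorphisms of the plane\<close>

text \<open>Abstracts from polynomials: \<open>g i\<close> is a homeomorphism of the plane with
  inverse \<open>h i\<close>, and \<open>f i\<close> is the height in the straightened coordinates,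
  so the sides of the curve become the upper and lower half planes.\<close>

locale straightened_family =
  fixes I :: "'i set" and f :: "'i \<Rightarrow> real \<times> real \<Rightarrow> real"
    and h g :: "'i \<Rightarrow> real \<times> real \<Rightarrow> real \<times> real"
  assumes finite_I: "finite I"
    and cont_h: "i \<in> I \<Longrightarrow> continuous_on UNIV (h i)"
    and cont_g: "i \<in> I \<Longrightarrow> continuous_on UNIV (g i)"
    and h_g: "i \<in> I \<Longrightarrow> h i (g i z) = z"
    and g_h: "i \<in> I \<Longrightarrow> g i (h i w) = w"
    and f_eq: "i \<in> I \<Longrightarrow> f i z = snd (g i z)"
begin

text \<open>Parametrizes the zero set of \<open>f i\<close> by the horizontal axis of the
  straightened plane.\<close>

definition \<gamma> :: "'i \<Rightarrow> real \<Rightarrow> real \<times> real" where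
  "\<gamma> i t = h i (t, 0)"

lemma f_h: "i \<in> I \<Longrightarrow> f i (h i w) = snd w"
  by (simp add: f_eq g_h)

lemma f_\<gamma>: "i \<in> I \<Longrightarrow> f i (\<gamma> i t) = 0"
  by (simp add: f_h \<gamma>_def)

lemma cont_f: "i \<in> I \<Longrightarrow> continuous_on UNIV (f i)"
  using continuous_on_snd[OF cont_g] f_eq by (simp cong: continuous_on_cong)

lemma zero_eq_\<gamma>: "\<lbrakk>i \<in> I; f i z = 0\<rbrakk> \<Longrightarrow> z = \<gamma> i (fst (g i z))"
  by (metis \<gamma>_def f_eq h_g prod.collapse)

lemma fst_g_\<gamma>: "i \<in> I \<Longrightarrow> fst (g i (\<gamma> i t)) = t"
  by (simp add: \<gamma>_def g_h)

lemma inj_\<gamma>: "i \<in> I \<Longrightarrow> inj (\<gamma> i)"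
  by (metis fst_g_\<gamma> injI)

lemma cont_\<gamma>: "i \<in> I \<Longrightarrow> continuous_on S (\<gamma> i)"
  unfolding \<gamma>_def
  by (rule continuous_on_compose2[OF cont_h]) (auto intro!: continuous_intros)

lemma h_image: "i \<in> I \<Longrightarrow> h i ` A = g i -` A"
  using h_g g_h by (auto simp: image_iff) metis

lemma h_closure: "i \<in> I \<Longrightarrow> h i ` closure A = closure (h i ` A)"
proof (rule antisym)
  assume i: "i \<in> I"
  show "h i ` closure A \<subseteq> closure (h i ` A)"
    using cont_h[OF i] by (metis closed_closure closure_subset image_closure_subset continuous_on_subset top_greatest)
  have "closed (h i ` closure A)"
    unfolding h_image[OF i] using cont_g[OF i] by (simp add: closed_vimage)
  then show "closure (h i ` A) \<subseteq> h i ` closure A"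
    by (simp add: closure_minimal closure_subset image_mono)
qed

lemma h_open: "\<lbrakk>i \<in> I; open A\<rbrakk> \<Longrightarrow> open (h i ` A)"
  using cont_g by (simp add: h_image open_vimage)

lemma h_connected: "\<lbrakk>i \<in> I; connected A\<rbrakk> \<Longrightarrow> connected (h i ` A)"
  using cont_h by (meson connected_continuous_image continuous_on_subset top_greatest)

text \<open>The factor \<open>s\<close> serves both sides at once: \<open>s = 1\<close> gives the
  positive and \<open>s = -1\<close> the negative one.\<close>

lemma connected_side:
  assumes i: "i \<in> I"
  shows "connected {z. f i z * s > 0}"
proof -
  have "convex (snd -` {u. u * s > 0} :: (real \<times> real) set)"
    using convex_halfspace_gt[of 0 "(0, s) :: real \<times> real"] by (simp add: vimage_def inner_prod_def mult.commute)
  then have "connected (h i ` (snd -` {u. u * s > 0}))"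
    using h_connected[OF i] convex_connected by blast
  moreover have "h i ` (snd -` {u. u * s > 0}) = {z. f i z * s > 0}"
    using f_eq[OF i] by (simp add: h_image[OF i] set_eq_iff)
  ultimately show ?thesis
    by simp
qed

text \<open>Otherwise its closure would be compact and have a bounded image under
  \<open>g i\<close>, but that image contains the horizontal line at height -1.\<close>

lemma unbounded_negative: "i \<in> I \<Longrightarrow> \<not> bounded {z. f i z < 0}"
proof
  assume i: "i \<in> I" and b: "bounded {z. f i z < 0}"
  have "compact (g i ` closure {z. f i z < 0})"
    using b cont_g[OF i] by (meson compact_closure compact_continuous_image continuous_on_subset top_greatest)
  then have "bounded (g i ` {z. f i z < 0})"
    by (meson bounded_subset closure_subset compact_imp_bounded image_mono)
  moreover have "UNIV \<times> {-1} \<subseteq> g i ` {z. f i z < 0}"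
  proof
    fix w :: "real \<times> real" assume "w \<in> UNIV \<times> {-1}"
    then show "w \<in> g i ` {z. f i z < 0}"
      using g_h[OF i] f_h[OF i] by (intro image_eqI[of _ _ "h i w"]) auto
  qed
  ultimately have "bounded (fst ` (UNIV \<times> {-1::real}) :: real set)"
    using bounded_fst bounded_subset by blast
  then show False
    by simp
qed

lemma zero_in_closure_h:
  assumes i: "i \<in> I" and z: "f i z = 0" "z \<in> h i ` A" and A: "open A" and s: "s \<noteq> 0"
  shows "z \<in> closure (h i ` (A \<inter> {w. snd w * s > 0}))"
proof -
  obtain w where w: "w \<in> A" "z = h i w"
    using z by blast
  have w0: "snd w = 0"
    using z(1) i w by (simp add: f_h)
  have "w \<in> closure (A \<inter> {w. snd w * s > 0})"
    unfolding closure_approachable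
  proof (intro allI impI)
    fix e :: real assume "e > 0"
    obtain d where d: "d > 0" "ball w d \<subseteq> A"
      using A w(1) open_contains_ball by blast
    \<comment> \<open>A vertical shift of \<open>w\<close> off the axis towards the side given by
      \<open>s\<close>; \<open>d\<close> keeps it inside \<open>A\<close> and \<open>e\<close> keeps
      it close to \<open>w\<close>.\<close>
    define u where "u = min d e / 2 * sgn s"
    have "dist (fst w, u) w < min d e" "u * s > 0"
      using s w0 \<open>e > 0\<close> d(1)
      by (auto simp: u_def dist_prod_def abs_mult sgn_mult abs_sgn_eq sgn_real_def mult_neg_neg mult_pos_neg)
    then show "\<exists>y\<in>A \<inter> {w. snd w * s > 0}. dist y w < e"
      using d(2) by (intro bexI[of _ "(fst w, u)"]) (auto simp: dist_commute subset_iff)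
  qed
  then show ?thesis
    using h_closure[OF i] w(2) by blast
qed

lemma zero_in_closure_side:
  assumes i: "i \<in> I" and z: "f i z = 0" and s: "s \<noteq> 0"
  shows "z \<in> closure {z. f i z * s > 0}"
proof -
  have "z \<in> closure (h i ` (UNIV \<inter> {w. snd w * s > 0}))"
    using i z s by (intro zero_in_closure_h) (auto simp: h_image)
  moreover have "h i ` (UNIV \<inter> {w. snd w * s > 0}) = {z. f i z * s > 0}"
    using f_eq[OF i] by (simp add: h_image[OF i] set_eq_iff)
  ultimately show ?thesis
    by simp
qed

lemma same_sign_on_connected:
  assumes "i \<in> I" "connected S" "\<And>z. z \<in> S \<Longrightarrow> f i z \<noteq> 0" "x \<in> S" "y \<in> S"
  shows "f i x * f i y > 0"
proof (rule ccontr)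
  assume n: "\<not> f i x * f i y > 0"
  have conn: "connected (f i ` S)"
    using assms(1,2) cont_f by (meson connected_continuous_image continuous_on_subset top_greatest)
  have "f i x \<le> 0 \<and> 0 \<le> f i y \<or> f i y \<le> 0 \<and> 0 \<le> f i x"
    using n by (simp add: zero_less_mult_iff) linarith
  then have "0 \<in> f i ` S"
    using connectedD_interval[OF conn] assms(4,5) by blast
  then show False
    using assms(3) by force
qed

text \<open>A point of the larger zero set off the smaller one would link both sides of the larger one
  to a connected dense set on which \<open>f i\<close> never vanishes.\<close>
lemma zero_set_subset_imp_eq:
  assumes i: "i \<in> I" and j: "j \<in> I" and sub: "{z. f i z = 0} \<subseteq> {z. f j z = 0}"
  shows "{z. f j z = 0} \<subseteq> {z. f i z = 0}"
proof (rule ccontr)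
  assume "\<not> ?thesis"
  then obtain w where w: "f j w = 0" "f i w \<noteq> 0"
    by blast
  define S where "S = insert w {z. f j z * 1 > 0} \<union> insert w {z. f j z * (-1) > 0}"
  have "connected (insert w {z. f j z * s > 0})" if "s \<noteq> 0" for s
  proof (rule connected_intermediate_closure[OF connected_side[OF j, of s]])
    show "insert w {z. f j z * s > 0} \<subseteq> closure {z. f j z * s > 0}"
      using zero_in_closure_side[OF j w(1) that] by (simp add: closure_subset)
  qed (rule subset_insertI)
  from this[of 1] this[of "-1"] have "connected S"
    unfolding S_def by (intro connected_Un) auto
  moreover have "f i z \<noteq> 0" if "z \<in> S" for z
    using that sub w by (auto simp: S_def)
  ultimately have pos: "f i w * f i z > 0" if "z \<in> S" for z
    using same_sign_on_connected[OF i, of S w z] that by (auto simp: S_def)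
  have "closed {z. 0 \<le> f i w * f i z}"
    using cont_f[OF i] by (intro closed_Collect_le continuous_intros) auto
  then have cl: "closure S \<subseteq> {z. 0 \<le> f i w * f i z}"
    using pos by (intro closure_minimal) (auto intro: less_imp_le)
  \<comment> \<open>A point where \<open>f i\<close> has the sign opposite to that at
    \<open>w\<close>. It cannot lie in \<open>closure S\<close>, although \<open>S\<close> is
    dense.\<close>
  define z where "z = h i (0, - f i w)"
  have "f i w * f i z < 0"
  proof -
    have "f i w * f i z = - (f i w)\<^sup>2"
      using f_h[OF i] by (simp add: z_def power2_eq_square)
    then show ?thesis
      using w(2) by simp
  qed
  then have "z \<notin> closure S"
    using cl by auto
  moreover have "z \<in> S" if "f j z \<noteq> 0"
    using that by (auto simp: S_def)
  moreover have "z \<in> closure S" if "f j z = 0"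
    using zero_in_closure_side[OF j that, of 1] closure_mono[of "{z. f j z * 1 > 0}" S] by (auto simp: S_def)
  ultimately show False
    using closure_subset by blast
qed

text \<open>The zero sets coincide, so each positive side is a connected set avoiding the other zero
  set. The common point \<open>x\<close> excludes the case of opposite sides of one curve.\<close>

lemma zero_set_subset_imp_half_planes:
  assumes i: "i \<in> I" and j: "j \<in> I" and sub: "{z. f i z = 0} \<subseteq> {z. f j z = 0}"
    and x: "f i x > 0" "f j x > 0"
  shows "{z. f i z > 0} = {z. f j z > 0}"
proof -
  have *: "{z. f i z > 0} \<subseteq> {z. f j z > 0}"
    if "i \<in> I" "j \<in> I" "{z. f j z = 0} \<subseteq> {z. f i z = 0}" "f i x > 0" "f j x > 0" for i j
  proof
    fix y assume "y \<in> {z. f i z > 0}"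
    then have "f j x * f j y > 0"
      using that connected_side[OF that(1), of 1]
      by (intro same_sign_on_connected[OF that(2), of "{z. f i z > 0}"]) auto
    then show "y \<in> {z. f j z > 0}"
      using that(5) by (simp add: zero_less_mult_iff)
  qed
  show ?thesis
    using *[OF i j zero_set_subset_imp_eq[OF i j sub]] *[OF j i sub] x by blast
qed

end

section \<open>Components of the intersection and their behaviour near the curves\<close>

locale straightened_curves = straightened_family I f h g
  for I :: "'i set" and f :: "'i \<Rightarrow> real \<times> real \<Rightarrow> real"
    and h g :: "'i \<Rightarrow> real \<times> real \<Rightarrow> real \<times> real" +
  assumes finite_crossings: "\<lbrakk>i \<in> I; j \<in> I; i \<noteq> j\<rbrakk> \<Longrightarrow> finite {z. f i z = 0 \<and> f j z = 0}"
begin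

definition X :: "(real \<times> real) set" where
  "X = {z. \<forall>i\<in>I. f i z > 0}"

text \<open>The crossings, where the half-disc picture of \<open>X\<close> may fail.\<close>

definition V :: "(real \<times> real) set" where
  "V = (\<Union>i\<in>I. \<Union>j\<in>I - {i}. {z. f i z = 0 \<and> f j z = 0})"

text \<open>An edge is the piece of a curve between crossings. It is stored as the index of the
  curve and the open parameter interval \<open>C\<close>, which makes connectedness and closures
  questions about the line.\<close>

definition edges :: "('i \<times> real set) set" where
  "edges = (SIGMA i:I. components (- {t. \<gamma> i t \<in> V}))"

lemma finite_V: "finite V"
  unfolding V_def using finite_I finite_crossings by auto

lemma open_X: "open X"
proof -
  have "X = (\<Inter>i\<in>I. f i -` {0<..})"
    by (auto simp: X_def)
  then show ?thesis
    using finite_I cont_f by (auto intro!: open_INT open_vimage)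
qed

lemma closure_X_nonneg: "\<lbrakk>z \<in> closure X; i \<in> I\<rbrakk> \<Longrightarrow> f i z \<ge> 0"
proof -
  assume z: "z \<in> closure X" and i: "i \<in> I"
  have "closed (f i -` {0..})"
    using cont_f[OF i] by (simp add: closed_vimage)
  moreover have "X \<subseteq> f i -` {0..}"
    using i by (force simp: X_def)
  ultimately show ?thesis
    using z closure_minimal by blast
qed

text \<open>Every neighbourhood of a zero of \<open>f i\<close> also contains points with
  \<open>f i\<close> negative, so the value cannot be 0.\<close>

lemma interior_nonneg: "\<lbrakk>i \<in> I; open N; z \<in> N; \<And>w. w \<in> N \<Longrightarrow> f i w \<ge> 0\<rbrakk> \<Longrightarrow> f i z > 0"
proof (rule ccontr)
  assume *: "i \<in> I" "open N" "z \<in> N" "\<And>w. w \<in> N \<Longrightarrow> f i w \<ge> 0" "\<not> f i z > 0"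
  then have "f i z = 0"
    by (simp add: order.antisym)
  then have "z \<in> closure {z. f i z * (-1) > 0}"
    by (rule zero_in_closure_side[OF *(1)]) simp
  then have "{z. f i z * (-1) > 0} \<inter> N \<noteq> {}"
    using *(2,3) by (meson closure_iff_nhds_not_empty order_refl)
  then show False
    using *(4) by force
qed

text \<open>Off the crossings every other \<open>f j\<close> is positive at \<open>z\<close>, hence
  on a neighbourhood. There only the sign of \<open>f i\<close> matters, and in straightened
  coordinates \<open>X\<close> is the upper part of a ball centred on the axis.\<close>

lemma local_half_disc:
  assumes i: "i \<in> I" and z: "f i z = 0" "z \<notin> V" "z \<in> closure X"
  obtains N where "open N" "z \<in> N" "connected (N \<inter> X)" "N \<inter> {w. f i w = 0} \<subseteq> closure (N \<inter> X)"
proof -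
  have pos: "f j z > 0" if "j \<in> I - {i}" for j
  proof -
    have "f j z \<noteq> 0"
      using that i z(1,2) by (auto simp: V_def)
    then show ?thesis
      using closure_X_nonneg[OF z(3), of j] that by auto
  qed
  define O' where "O' = (\<Inter>j\<in>I - {i}. f j -` {0<..})"
  have "open O'"
    unfolding O'_def using finite_I cont_f by (auto intro!: open_INT open_vimage)
  then have "open (h i -` O')"
    using cont_h[OF i] by (simp add: open_vimage)
  moreover have "g i z \<in> h i -` O'"
    using pos h_g[OF i] by (auto simp: O'_def)
  ultimately obtain e where e: "e > 0" "ball (g i z) e \<subseteq> h i -` O'"
    using open_contains_ball by blast
  define N where "N = h i ` ball (g i z) e"
  have N: "N \<inter> X = h i ` (ball (g i z) e \<inter> {w. snd w * 1 > 0})"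
  proof -
    have "h i w \<in> X \<longleftrightarrow> snd w > 0" if "w \<in> ball (g i z) e" for w
    proof -
      have "h i w \<in> O'"
        using e(2) that by blast
      then show ?thesis
        using i f_h[OF i, of w] by (auto simp: X_def O'_def)
    qed
    then show ?thesis
      by (auto simp: N_def)
  qed
  show ?thesis
  proof
    show "open N"
      unfolding N_def using h_open[OF i] by simp
    show "z \<in> N"
        unfolding N_def using h_g[OF i, of z] e(1) by (metis centre_in_ball imageI)
    have "{w::real \<times> real. snd w * 1 > 0} = UNIV \<times> {0<..}"
      by auto
    then have "convex (ball (g i z) e \<inter> {w. snd w * 1 > 0})"
      by (metis convex_Int convex_Times convex_UNIV convex_ball convex_real_interval(3))
    then show "connected (N \<inter> X)"
      unfolding N using h_connected[OF i] convex_connected by blast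
    show "N \<inter> {w. f i w = 0} \<subseteq> closure (N \<inter> X)"
      unfolding N using zero_in_closure_h[OF i, of _ "ball (g i z) e" 1] by (auto simp: N_def)
  qed
qed

lemma component_facts:
  assumes "U \<in> components X"
  shows "open U" "connected U" "U \<noteq> {}" "U \<subseteq> X" "closure U \<subseteq> closure X"
  using open_components[OF open_X assms] in_components_connected[OF assms] in_components_nonempty[OF assms]
    in_components_subset[OF assms] closure_mono[OF in_components_subset[OF assms]] by simp_all

text \<open>The half disc is connected and meets \<open>U\<close>, so the component \<open>U\<close>
  absorbs it.\<close>

lemma local_component:
  assumes U: "U \<in> components X" and i: "i \<in> I" and z: "f i z = 0" "z \<notin> V" "z \<in> closure U"
  obtains N where "open N" "z \<in> N" "N \<inter> X \<subseteq> U" "N \<inter> {w. f i w = 0} \<subseteq> closure U"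
proof -
  have "z \<in> closure X"
    using component_facts(5)[OF U] z(3) by blast
  then obtain N where N: "open N" "z \<in> N" "connected (N \<inter> X)" "N \<inter> {w. f i w = 0} \<subseteq> closure (N \<inter> X)"
    by (rule local_half_disc[OF i z(1,2)])
  have "U \<inter> N \<noteq> {}"
    using N(1,2) z(3) by (metis closure_iff_nhds_not_empty inf_commute order_refl)
  then have "U \<inter> (N \<inter> X) \<noteq> {}"
    using component_facts(4)[OF U] by blast
  then have sub: "N \<inter> X \<subseteq> U"
    by (rule components_maximal[OF U N(3) Int_lower2])
  show ?thesis
    using that[OF N(1,2) sub] subset_trans[OF N(4) closure_mono[OF sub]] .
qed

text \<open>All of \<open>X\<close> near \<open>z\<close> lies in \<open>U\<close>, so a component
  with \<open>z\<close> in its closure must meet \<open>U\<close>.\<close>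

lemma component_unique:
  assumes U: "U \<in> components X" and W: "W \<in> components X"
    and i: "i \<in> I" and z: "f i z = 0" "z \<notin> V" "z \<in> closure U" "z \<in> closure W"
  shows "U = W"
proof -
  obtain N where N: "open N" "z \<in> N" "N \<inter> X \<subseteq> U" "N \<inter> {w. f i w = 0} \<subseteq> closure U"
    by (rule local_component[OF U i z(1-3)])
  have "W \<inter> N \<noteq> {}"
    using N(1,2) z(4) by (metis closure_iff_nhds_not_empty inf_commute order_refl)
  then have "U \<inter> W \<noteq> {}"
    using N(3) component_facts(4)[OF W] by blast
  then show ?thesis
    using components_eq[OF U W] by blast
qed

text \<open>The component containing \<open>z\<close> is an open neighbourhood of \<open>z\<close>,
  so it meets \<open>U\<close> and equals it.\<close>

lemma in_X_closure_component:
  assumes U: "U \<in> components X" and "z \<in> closure U" "z \<in> X"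
  shows "z \<in> U"
proof -
  obtain W where W: "W \<in> components X" "z \<in> W"
    using assms(3) by (metis UnionE Union_components)
  then have "U \<inter> W \<noteq> {}"
    using assms(2) component_facts(1)[OF W(1)]
    by (metis closure_iff_nhds_not_empty inf_commute order_refl)
  then show ?thesis
    using components_eq[OF U W(1)] W(2) by blast
qed

text \<open>On the interior of \<open>closure U\<close> every \<open>f i\<close> is nonnegative,
  hence positive by \<open>interior_nonneg\<close>; so that interior adds no points outside
  \<open>X\<close>.\<close>

lemma interior_closure_component:
  assumes U: "U \<in> components X"
  shows "interior (closure U) = U"
proof
  show "interior (closure U) \<subseteq> U"
  proof
    fix z assume z: "z \<in> interior (closure U)"
    have "f i z > 0" if "i \<in> I" for i
    proof (rule interior_nonneg[OF that open_interior z])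
      fix w assume "w \<in> interior (closure U)"
      then show "f i w \<ge> 0"
        using closure_X_nonneg[OF _ that] component_facts(5)[OF U] interior_subset by blast
    qed
    then have "z \<in> X"
      by (simp add: X_def)
    then show "z \<in> U"
      using in_X_closure_component[OF U] z interior_subset by blast
  qed
  show "U \<subseteq> interior (closure U)"
    by (simp add: component_facts(1)[OF U] closure_subset interior_maximal)
qed

lemma frontier_component_zero:
  assumes U: "U \<in> components X" and z: "z \<in> frontier U"
  shows "\<exists>i\<in>I. f i z = 0"
proof (rule ccontr)
  assume n: "\<not> ?thesis"
  have zc: "z \<in> closure U" "z \<notin> U"
    using z component_facts(1)[OF U] by (auto simp: frontier_def interior_open)
  have "f i z > 0" if "i \<in> I" for i
  proof -
    have "f i z \<ge> 0"
      using closure_X_nonneg[OF _ that] component_facts(5)[OF U] zc by blast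
    then show ?thesis
      using n that by (metis order_le_less)
  qed
  then show False
    using in_X_closure_component[OF U zc(1)] zc(2) by (simp add: X_def)
qed

text \<open>A crossing isolated in the frontier would have a punctured disc around it inside U, contradicting that U is regular open.\<close>
lemma frontier_component_subset_closure:
  assumes U: "U \<in> components X"
  shows "frontier U \<subseteq> closure (frontier U - V)"
proof
  fix z assume z: "z \<in> frontier U"
  show "z \<in> closure (frontier U - V)"
  proof (rule ccontr)
    assume "z \<notin> closure (frontier U - V)"
    then obtain e where e: "e > 0" "ball z e \<inter> (frontier U - V) = {}"
      by (metis closure_approachable dist_commute disjoint_iff mem_ball)
    have conn: "connected (ball z e - V)"
      using finite_V by (intro connected_open_delete_finite) auto
    have "open (ball z e)"
      by simp
    moreover have "ball z e \<inter> U \<noteq> {}"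
      using z e(1) by (metis Diff_iff calculation centre_in_ball closure_iff_nhds_not_empty frontier_def inf_commute order_refl)
    ultimately obtain w where w: "w \<in> ball z e \<inter> U"
      by blast
    have "open (ball z e \<inter> U)"
      using component_facts(1)[OF U] by blast
    then have "infinite (ball z e \<inter> U)"
      using w by (metis empty_iff finite_imp_not_open)
    then have "\<not> ball z e \<inter> U \<subseteq> V"
      using finite_V finite_subset by blast
    then have "(ball z e - V) \<inter> U \<noteq> {}"
      by blast
    then have sub: "ball z e - V \<subseteq> U"
      using connected_Int_frontier[OF conn, of U] e(2) by blast
    have "ball z e \<subseteq> closure (ball z e - V)"
    proof
      fix x assume x: "x \<in> ball z e"
      show "x \<in> closure (ball z e - V)"
        unfolding closure_iff_nhds_not_empty
      proof (intro allI impI)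
        fix A T assume T: "T \<subseteq> A" "open T" "x \<in> T"
        then have "infinite (T \<inter> ball z e)"
          using x by (metis IntI empty_iff finite_imp_not_open open_Int open_ball)
        then have "\<not> T \<inter> ball z e \<subseteq> V"
          using finite_V finite_subset by blast
        then show "(ball z e - V) \<inter> A \<noteq> {}"
          using T(1) by blast
      qed
    qed
    then have "ball z e \<subseteq> closure U"
      using sub closure_mono by blast
    then have "z \<in> U"
      using interior_closure_component[OF U] e(1) by (metis centre_in_ball interior_maximal open_ball subsetD)
    then show False
      using z component_facts(1)[OF U] by (auto simp: frontier_def interior_open)
  qed
qed

section \<open>Edges between crossings, frontiers, and finiteness of the components\<close>

lemma finite_preimage_V: "i \<in> I \<Longrightarrow> finite {t. \<gamma> i t \<in> V}"
  using finite_vimageI[OF finite_V inj_\<gamma>] by (simp add: vimage_def)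

lemma finite_edges: "finite edges"
  unfolding edges_def using finite_I
  by (auto intro!: finite_components_Compl_finite_real finite_preimage_V)

lemma edge_through:
  assumes i: "i \<in> I" and "f i z = 0" "z \<notin> V"
  obtains C where "(i, C) \<in> edges" "z \<in> \<gamma> i ` C"
proof -
  define t where "t = fst (g i z)"
  have t: "z = \<gamma> i t"
    using assms zero_eq_\<gamma> by (simp add: t_def)
  then have "t \<in> \<Union>(components (- {t. \<gamma> i t \<in> V}))"
    using assms(3) by (simp add: Union_components[symmetric])
  then obtain C where "C \<in> components (- {t. \<gamma> i t \<in> V})" "t \<in> C"
    by blast
  then show ?thesis
    using that i t by (auto simp: edges_def)
qed

lemma edge_facts:
  assumes "(i, C) \<in> edges"
  shows "i \<in> I" "C \<noteq> {}" "open C" "connected C" "\<gamma> i ` C \<inter> V = {}" "\<gamma> i ` C \<subseteq> {z. f i z = 0}"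
proof -
  show i: "i \<in> I"
    using assms by (auto simp: edges_def)
  have C: "C \<in> components (- {t. \<gamma> i t \<in> V})"
    using assms by (auto simp: edges_def)
  show "C \<noteq> {}" "connected C" "\<gamma> i ` C \<inter> V = {}"
    using C in_components_nonempty in_components_connected in_components_subset by fastforce+
  show "open C"
    using open_components[OF _ C] finite_imp_closed[OF finite_preimage_V[OF i]] by (simp add: open_Compl)
  show "\<gamma> i ` C \<subseteq> {z. f i z = 0}"
    using f_\<gamma>[OF i] by auto
qed

text \<open>The part of the edge in \<open>closure U\<close> is relatively closed, and relatively
  open by \<open>local_component\<close>; a connected edge that meets \<open>closure U\<close> is
  therefore contained in it.\<close>

lemma edge_in_closure:
  assumes U: "U \<in> components X" and E: "(i, C) \<in> edges" and meet: "\<gamma> i ` C \<inter> closure U \<noteq> {}"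
  shows "\<gamma> i ` C \<subseteq> frontier U"
proof -
  note e = edge_facts[OF E]
  let ?A = "\<gamma> i ` C"
  have conn: "connected ?A"
    using e(1,4) cont_\<gamma> connected_continuous_image by blast
  have "openin (top_of_set ?A) (?A \<inter> closure U)"
  proof (subst openin_subopen, intro ballI)
    fix z assume z: "z \<in> ?A \<inter> closure U"
    then have fz: "f i z = 0" "z \<notin> V"
      using e(5,6) by auto
    have "z \<in> closure U"
      using z by blast
    then obtain N where N: "open N" "z \<in> N" "N \<inter> X \<subseteq> U" "N \<inter> {w. f i w = 0} \<subseteq> closure U"
      by (rule local_component[OF U e(1) fz])
    have "openin (top_of_set ?A) (?A \<inter> N)"
      using N(1) by (simp add: openin_open_Int)
    moreover have "z \<in> ?A \<inter> N"
      using z N(2) by simp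
    moreover have "?A \<inter> N \<subseteq> ?A \<inter> closure U"
      using N(4) e(6) by auto
    ultimately show "\<exists>T. openin (top_of_set ?A) T \<and> z \<in> T \<and> T \<subseteq> ?A \<inter> closure U"
      by blast
  qed
  moreover have "closedin (top_of_set ?A) (?A \<inter> closure U)"
    by (simp add: closedin_closed_Int)
  ultimately have "?A \<subseteq> closure U"
    using conn meet unfolding connected_clopen by blast
  moreover have "?A \<inter> U = {}"
    using e(1,6) component_facts(4)[OF U] by (force simp: X_def)
  ultimately show ?thesis
    using component_facts(1)[OF U] by (auto simp: frontier_def interior_open)
qed

lemma frontier_edge:
  assumes U: "U \<in> components X" and z: "z \<in> frontier U - V"
  obtains i C where "(i, C) \<in> edges" "z \<in> \<gamma> i ` C" "\<gamma> i ` C \<subseteq> frontier U"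
proof -
  obtain i where i: "i \<in> I" "f i z = 0"
    using frontier_component_zero[OF U] z by blast
  moreover have "z \<notin> V"
    using z by blast
  ultimately obtain C where C: "(i, C) \<in> edges" "z \<in> \<gamma> i ` C"
    by (rule edge_through)
  have "z \<in> closure U"
    using z by (simp add: frontier_def)
  then have "\<gamma> i ` C \<subseteq> frontier U"
    using edge_in_closure[OF U C(1)] C(2) by blast
  then show ?thesis
    by (rule that[OF C])
qed

text \<open>The parametrization is a closed embedding: the image of \<open>closure C\<close> is the
  preimage under \<open>g i\<close> of a closed subset of the axis.\<close>

lemma closure_edge:
  assumes E: "(i, C) \<in> edges"
  shows "closure (\<gamma> i ` C) = \<gamma> i ` closure C"
proof
  note i = edge_facts(1)[OF E]
  have eq: "\<gamma> i ` closure C = g i -` (closure C \<times> {0})"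
  proof (intro equalityI subsetI)
    fix z assume "z \<in> g i -` (closure C \<times> {0})"
    then have "z = \<gamma> i (fst (g i z))" "fst (g i z) \<in> closure C"
      using zero_eq_\<gamma>[OF i, of z] f_eq[OF i, of z] by auto
    then show "z \<in> \<gamma> i ` closure C"
      by (rule image_eqI)
  qed (auto simp: \<gamma>_def g_h[OF i])
  have "closed (\<gamma> i ` closure C)"
    unfolding eq using cont_g[OF i] by (intro closed_vimage closed_Times) auto
  then show "closure (\<gamma> i ` C) \<subseteq> \<gamma> i ` closure C"
    by (simp add: closure_minimal closure_subset image_mono)
  show "\<gamma> i ` closure C \<subseteq> closure (\<gamma> i ` C)"
    using cont_\<gamma>[OF i] by (intro image_closure_subset) (auto simp: closure_subset)
qed

text \<open>A limit parameter that is not a crossing could be added to \<open>C\<close> keeping it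
  connected, so maximality of the component already puts it in \<open>C\<close>.\<close>

lemma closure_edge_subset:
  assumes E: "(i, C) \<in> edges"
  shows "closure (\<gamma> i ` C) \<subseteq> \<gamma> i ` C \<union> V"
proof -
  have C: "C \<in> components (- {t. \<gamma> i t \<in> V})"
    using E by (auto simp: edges_def)
  have "t \<in> C" if t: "t \<in> closure C" "\<gamma> i t \<notin> V" for t
  proof -
    have "connected (insert t C)"
      using t(1) closure_subset[of C]
      by (intro connected_intermediate_closure[OF edge_facts(4)[OF E]]) auto
    then have "insert t C \<subseteq> C"
      using C t(2) edge_facts(2)[OF E] in_components_subset[OF C] by (intro components_maximal[OF C]) auto
    then show ?thesis
      by blast
  qed
  then show ?thesis
    unfolding closure_edge[OF E] by blast
qed

lemma homeomorphic_closure_edge: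
  assumes E: "(i, C) \<in> edges"
  shows "closure C homeomorphic closure (\<gamma> i ` C)"
proof -
  note i = edge_facts(1)[OF E]
  have "homeomorphism (closure C) (\<gamma> i ` closure C) (\<gamma> i) (fst \<circ> g i)"
    unfolding homeomorphism_def using cont_\<gamma>[OF i] fst_g_\<gamma>[OF i] cont_g[OF i]
    by (auto simp: image_image intro!: continuous_intros continuous_on_compose intro: continuous_on_subset)
  then show ?thesis
    unfolding closure_edge[OF E] homeomorphic_def by blast
qed

text \<open>Distinct open edges meet only in crossings: on one curve they are disjoint, on two
  curves common points are in \<open>V\<close> by definition. Closing them adds only
  crossings.\<close>

lemma finite_Int_closure_edges:
  assumes E: "(i, C) \<in> edges" "(j, D) \<in> edges" and ne: "(i, C) \<noteq> (j, D)"
  shows "finite (closure (\<gamma> i ` C) \<inter> closure (\<gamma> j ` D))"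
proof -
  have "\<gamma> i ` C \<inter> \<gamma> j ` D \<subseteq> V"
  proof (cases "i = j")
    case True
    then have "C \<inter> D = {}"
      using E ne components_nonoverlap by (fastforce simp: edges_def)
    then show ?thesis
      using image_Int[OF inj_\<gamma>[OF edge_facts(1)[OF E(1)]], of C D] True by simp
  next
    case False
    have "z \<in> V" if z: "z \<in> \<gamma> i ` C" "z \<in> \<gamma> j ` D" for z
    proof -
      have "f i z = 0" "f j z = 0"
        using z edge_facts(6)[OF E(1)] edge_facts(6)[OF E(2)] by blast+
      then show ?thesis
        using False edge_facts(1)[OF E(1)] edge_facts(1)[OF E(2)] unfolding V_def by blast
    qed
    then show ?thesis
      by blast
  qed
  then have "closure (\<gamma> i ` C) \<inter> closure (\<gamma> j ` D) \<subseteq> V"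
    using closure_edge_subset[OF E(1)] closure_edge_subset[OF E(2)] by blast
  then show ?thesis
    using finite_V finite_subset by blast
qed

text \<open>Closures are taken because the open edges omit the crossings and because gluing ANRs
  requires closed pieces.\<close>

definition sides :: "(real \<times> real) set \<Rightarrow> (real \<times> real) set set" where
  "sides U = (\<lambda>(i, C). closure (\<gamma> i ` C)) ` {(i, C) \<in> edges. \<gamma> i ` C \<subseteq> frontier U}"

lemma finite_sides: "finite (sides U)"
proof -
  have "finite {(i, C) \<in> edges. \<gamma> i ` C \<subseteq> frontier U}"
    by (rule finite_subset[OF _ finite_edges]) auto
  then show ?thesis
    by (simp add: sides_def)
qed

text \<open>Edges cover the frontier off the crossings; as the union of the sides is closed and
  those points are dense in the frontier, it covers the crossings there too.\<close>

lemma frontier_eq_sides: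
  assumes U: "U \<in> components X"
  shows "frontier U = \<Union>(sides U)"
proof
  have "closure (frontier U - V) \<subseteq> \<Union>(sides U)"
  proof (rule closure_minimal)
    show "closed (\<Union>(sides U))"
      using finite_sides by (intro closed_Union) (auto simp: sides_def)
    show "frontier U - V \<subseteq> \<Union>(sides U)"
    proof
      fix z assume "z \<in> frontier U - V"
      then obtain i C where "(i, C) \<in> edges" "z \<in> \<gamma> i ` C" "\<gamma> i ` C \<subseteq> frontier U"
        by (rule frontier_edge[OF U])
      then show "z \<in> \<Union>(sides U)"
        using closure_subset by (fastforce simp: sides_def)
    qed
  qed
  then show "frontier U \<subseteq> \<Union>(sides U)"
    using frontier_component_subset_closure[OF U] by blast
  show "\<Union>(sides U) \<subseteq> frontier U"
    by (auto simp: sides_def dest: subsetD[OF closure_minimal[OF _ frontier_closed]])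
qed

lemma side_props:
  assumes A: "A \<in> sides U"
  shows "is_arc A" "closed A" "ANR A" "\<exists>i\<in>I. A \<subseteq> {z. f i z = 0}"
proof -
  obtain i C where E: "(i, C) \<in> edges" and AC: "A = closure (\<gamma> i ` C)"
    using A by (auto simp: sides_def)
  note e = edge_facts[OF E]
  have int: "is_interval (closure C)"
    using e(4) by (simp add: is_interval_connected_1 connected_imp_connected_closure)
  obtain a where a: "a \<in> C"
    using e(2) by blast
  \<comment> \<open>A nonempty open set of reals is infinite, which makes the interval
    non-degenerate.\<close>
  have "infinite C"
    using e(2,3) finite_imp_not_open by blast
  then obtain b where "b \<in> C" "b \<noteq> a"
    by (metis finite.emptyI finite.insertI finite_subset insertI1 subsetI)
  then have "\<exists>a b. a \<in> closure C \<and> b \<in> closure C \<and> a \<noteq> b"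
    using a closure_subset by blast
  then show "is_arc A"
    unfolding is_arc_def AC using int homeomorphic_closure_edge[OF E] by blast
  show "closed A"
    by (simp add: AC)
  have "ANR (closure C)"
    using int by (simp add: convex_imp_ANR is_interval_convex)
  then show "ANR A"
    unfolding AC using homeomorphic_closure_edge[OF E] homeomorphic_ANR_iff_ANR by blast
  show "\<exists>i\<in>I. A \<subseteq> {z. f i z = 0}"
    unfolding AC closure_edge[OF E] using e(1) f_\<gamma> by blast
qed

text \<open>The frontier is nonempty and its points off \<open>V\<close> are dense in it, so one of
  them exists and lies on an edge. The whole plane, which arises for empty \<open>I\<close>, has no
  frontier.\<close>

lemma component_has_edge:
  assumes U: "U \<in> components X" and "U \<noteq> UNIV"
  obtains i C where "(i, C) \<in> edges" "\<gamma> i ` C \<subseteq> frontier U"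
proof -
  have "frontier U \<noteq> {}"
    using component_facts(3)[OF U] assms(2) by (simp add: frontier_eq_empty)
  then have "frontier U - V \<noteq> {}"
    using frontier_component_subset_closure[OF U] by (metis closure_empty subset_empty)
  then obtain z where "z \<in> frontier U - V"
    by blast
  then show ?thesis
    by (rule frontier_edge[OF U]) (rule that)
qed

lemma edge_determines_component:
  assumes U: "U \<in> components X" and W: "W \<in> components X" and E: "(i, C) \<in> edges"
    and "\<gamma> i ` C \<subseteq> closure U" "\<gamma> i ` C \<subseteq> closure W"
  shows "U = W"
proof -
  note e = edge_facts[OF E]
  obtain z where "z \<in> \<gamma> i ` C"
    using e(2) by blast
  then show ?thesis
    using assms(4,5) e component_unique[OF U W e(1), of z] by blast
qed

text \<open>Choosing a bordering edge for each component other than the plane is injective, since an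
  edge borders at most one component.\<close>

lemma finite_components_X: "finite (components X)"
proof -
  have "\<exists>E. E \<in> edges \<and> \<gamma> (fst E) ` snd E \<subseteq> frontier U" if "U \<in> components X - {UNIV}" for U
  proof -
    have "U \<in> components X" "U \<noteq> UNIV"
      using that by auto
    then obtain i C where "(i, C) \<in> edges" "\<gamma> i ` C \<subseteq> frontier U"
      by (rule component_has_edge)
    then show ?thesis
      by (intro exI[of _ "(i, C)"]) simp
  qed
  then obtain E where E: "\<And>U. U \<in> components X - {UNIV} \<Longrightarrow> E U \<in> edges \<and> \<gamma> (fst (E U)) ` snd (E U) \<subseteq> frontier U"
    by metis
  have "inj_on E (components X - {UNIV})"
  proof (rule inj_onI)
    fix U W assume UW: "U \<in> components X - {UNIV}" "W \<in> components X - {UNIV}" "E U = E W"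
    have "\<gamma> (fst (E U)) ` snd (E U) \<subseteq> closure U" "\<gamma> (fst (E U)) ` snd (E U) \<subseteq> closure W"
      using E[OF UW(1)] E[OF UW(2)] UW(3) by (auto simp: frontier_def)
    then show "U = W"
      using edge_determines_component[of U W "fst (E U)" "snd (E U)"] UW(1,2) E[OF UW(1)] by auto
  qed
  moreover have "E ` (components X - {UNIV}) \<subseteq> edges"
    using E by blast
  ultimately have "finite (components X - {UNIV})"
    using finite_edges inj_on_finite by blast
  then show ?thesis
    by simp
qed

section \<open>Closures of components are regions of type I\<close>

text \<open>\<open>ANR_from_Un_Int\<close> is applied to the closed sets \<open>closure U\<close>
  and \<open>- U\<close>: their union is the plane, and their intersection is the frontier, a union
  of finitely many sides with finite overlaps.\<close>

lemma ANR_closure_component: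
  assumes U: "U \<in> components X"
  shows "ANR (closure U)"
proof (rule ANR_from_Un_Int)
  show "closed (- U)"
    using component_facts(1)[OF U] by (rule closed_Compl)
  have "closure U \<union> - U = UNIV"
    using closure_subset by blast
  then show "ANR (closure U \<union> - U)"
    by simp
  have "closure U \<inter> - U = \<Union>(sides U)"
    using frontier_eq_sides[OF U] component_facts(1)[OF U] by (auto simp: frontier_def interior_open)
  moreover have "ANR (\<Union>(sides U))"
  proof (rule ANR_finite_Union_finite_Int[OF finite_sides])
    show "closed A \<and> ANR A" if "A \<in> sides U" for A
      using side_props[OF that] by blast
    show "finite (A \<inter> B)" if AB: "A \<in> sides U" "B \<in> sides U" "A \<noteq> B" for A B
    proof -
      obtain i C j D where *: "(i, C) \<in> edges" "A = closure (\<gamma> i ` C)" "(j, D) \<in> edges" "B = closure (\<gamma> j ` D)"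
        using AB(1,2) by (auto simp: sides_def)
      then have "(i, C) \<noteq> (j, D)"
        using AB(3) by auto
      then show ?thesis
        unfolding * using finite_Int_closure_edges[OF *(1,3)] by blast
    qed
  qed
  ultimately show "ANR (closure U \<inter> - U)"
    by simp
qed simp

text \<open>A bounded complementary component cannot meet any of the connected unbounded sets where some
  f i is negative, so it would be another component of X, all of whose sides also border U.\<close>
lemma unbounded_complement_component:
  assumes U: "U \<in> components X" and W: "W \<in> components (- closure U)"
  shows "\<not> bounded W"
proof
  assume bW: "bounded W"
  have oW: "open W"
    using W open_components by blast
  have nonneg: "f i z \<ge> 0" if i: "i \<in> I" and z: "z \<in> W" for i z
  proof (rule ccontr)
    assume "\<not> f i z \<ge> 0"
    then have "W \<inter> {z. f i z < 0} \<noteq> {}"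
      using z by auto
    moreover have "{z. f i z < 0} \<subseteq> - closure U"
      using closure_X_nonneg[OF _ i] component_facts(5)[OF U] by fastforce
    ultimately have "{z. f i z < 0} \<subseteq> W"
      using components_maximal[OF W connected_side[OF i, of "-1"]] by simp
    then show False
      using bW unbounded_negative[OF i] bounded_subset by blast
  qed
  have "W \<subseteq> X"
    using interior_nonneg[OF _ oW _ nonneg] by (auto simp: X_def)
  then obtain W' where W': "W' \<in> components X" "W \<subseteq> W'"
    using exists_component_superset[of W X] W in_components_connected in_components_nonempty by fastforce
  have wne: "W \<noteq> {}" "W \<inter> closure U = {}"
    using W in_components_nonempty in_components_subset by blast+
  have "W' \<noteq> U"
    using wne W'(2) closure_subset by blast
  then have "W' \<inter> U = {}"
    using components_eq[OF W'(1) U] by blast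
  then have "W' \<inter> closure U = {}"
    using component_facts(1)[OF W'(1)] open_Int_closure_eq_empty by blast
  then have "W' \<subseteq> W"
    using components_maximal[OF W component_facts(2)[OF W'(1)]] wne W'(2) by blast
  then have comp: "W \<in> components X"
    using W' by auto
  have "W \<noteq> UNIV"
    using bW by auto
  then obtain i C where E: "(i, C) \<in> edges" "\<gamma> i ` C \<subseteq> frontier W"
    by (rule component_has_edge[OF comp])
  \<comment> \<open>The frontier of a component of the complement of a closed set lies in that set,
    so the edge found for \<open>W\<close> also borders \<open>U\<close>.\<close>
  moreover have "frontier W \<subseteq> closure U"
    using frontier_of_components_closed_complement[OF closed_closure W] .
  ultimately have "U = W"
    using edge_determines_component[OF U comp E(1)] by (auto simp: frontier_def)
  then show False
    using wne closure_subset by blast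
qed

lemma region_typeI_closure_component:
  assumes U: "U \<in> components X"
    and graph: "\<And>i. i \<in> I \<Longrightarrow> \<exists>p \<theta>. {z. f i z = 0} \<subseteq> rot_poly_graph p \<theta>"
  shows "region_typeI (closure U)"
  unfolding region_typeI_def
proof (intro conjI)
  show "connected (closure U)"
    by (simp add: component_facts(2)[OF U] connected_imp_connected_closure)
  then show "simply_connected (closure U)"
    using simply_connected_closed_ANR_plane ANR_closure_component[OF U]
      unbounded_complement_component[OF U] by blast
  show "closure (interior (closure U)) = closure U"
    by (simp add: interior_closure_component[OF U])
  \<comment> \<open>Passing to the closure keeps the frontier because \<open>U\<close> is the
    interior of its closure.\<close>
  have "frontier (closure U) = \<Union>(sides U)"
    using frontier_eq_sides[OF U] component_facts(1)[OF U] interior_closure_component[OF U]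
    by (simp add: frontier_def interior_open)
  moreover have "is_arc A \<and> (\<exists>p \<theta>. A \<subseteq> rot_poly_graph p \<theta>)" if A: "A \<in> sides U" for A
  proof -
    obtain i where "i \<in> I" "A \<subseteq> {z. f i z = 0}"
      using side_props(4)[OF A] by blast
    then show ?thesis
      using side_props(1)[OF A] graph[of i] by (meson subset_trans)
  qed
  ultimately show "\<exists>S. finite S \<and> frontier (closure U) = \<Union>S
      \<and> (\<forall>A\<in>S. is_arc A \<and> (\<exists>p \<theta>. A \<subseteq> rot_poly_graph p \<theta>))"
    using finite_sides by (intro exI[of _ "sides U"]) simp
qed simp

end

section \<open>Straightening polynomial half planes, and the final assembly\<close>

text \<open>The inverse of \<open>straighten\<close>: \<open>v\<close> is the ordinate in the
  rotated frame, recovered from the abscissa \<open>fst w\<close> and the value \<open>snd w\<close>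
  of \<open>Phi\<close>; then the rotation is undone.\<close>

definition unstraighten :: "real poly \<Rightarrow> real \<Rightarrow> real \<times> real \<Rightarrow> real \<times> real" where
  "unstraighten p \<theta> w = (let v = poly p (fst w) - snd w
     in (fst w * cos \<theta> - v * sin \<theta>, fst w * sin \<theta> + v * cos \<theta>))"

definition straighten :: "real poly \<Rightarrow> real \<Rightarrow> real \<times> real \<Rightarrow> real \<times> real" where
  "straighten p \<theta> z = (fst z * cos \<theta> + snd z * sin \<theta>, Phi p \<theta> z)"

text \<open>The rotations by \<theta> and -\<theta> cancel. The four equations have the shape that
  unfolding produces, so that \<open>simp only\<close> can rewrite with them.\<close>

lemma rotate_back:
  fixes a b :: real
  shows "(a * cos \<theta> - b * sin \<theta>) * cos \<theta> + (a * sin \<theta> + b * cos \<theta>) * sin \<theta> = a"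
    and "- (a * cos \<theta> - b * sin \<theta>) * sin \<theta> + (a * sin \<theta> + b * cos \<theta>) * cos \<theta> = b"
    and "(a * cos \<theta> + b * sin \<theta>) * cos \<theta> - (- a * sin \<theta> + b * cos \<theta>) * sin \<theta> = a"
    and "(a * cos \<theta> + b * sin \<theta>) * sin \<theta> + (- a * sin \<theta> + b * cos \<theta>) * cos \<theta> = b"
  using sin_cos_squared_add[of \<theta>] by algebra+

lemma straighten_unstraighten: "straighten p \<theta> (unstraighten p \<theta> w) = w"
  by (simp only: straighten_def unstraighten_def Phi_def Let_def fst_conv snd_conv rotate_back) simp

lemma unstraighten_straighten: "unstraighten p \<theta> (straighten p \<theta> z) = z"
proof -
  define v where "v = - fst z * sin \<theta> + snd z * cos \<theta>"
  have "poly p (fst (straighten p \<theta> z)) - snd (straighten p \<theta> z) = v"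
    by (simp add: straighten_def Phi_def v_def)
  then show ?thesis
    unfolding unstraighten_def Let_def
    by (simp only:) (simp only: straighten_def fst_conv v_def rotate_back prod.collapse)
qed

lemma straightened_family_Phi:
  fixes k :: nat
  shows "straightened_family {..<k} (\<lambda>i. Phi (p i) (\<theta> i)) (\<lambda>i. unstraighten (p i) (\<theta> i)) (\<lambda>i. straighten (p i) (\<theta> i))"
proof
  show "continuous_on UNIV (unstraighten (p i) (\<theta> i))" for i
    unfolding unstraighten_def Let_def by (intro continuous_intros)
  show "continuous_on UNIV (straighten (p i) (\<theta> i))" for i
    unfolding straighten_def Phi_def by (intro continuous_intros)
  show "Phi (p i) (\<theta> i) z = snd (straighten (p i) (\<theta> i) z)" for i z
    by (simp add: straighten_def)
qed (simp_all add: straighten_unstraighten unstraighten_straighten)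

lemma Phi_along_graph_poly:
  obtains r where "\<And>t. Phi q \<phi> (unstraighten p \<theta> (t, 0)) = poly r t"
proof -
  \<comment> \<open>\<open>x\<close> and \<open>y\<close> are the plane coordinates, as polynomials
    in \<open>t\<close>, of the point of the graph of \<open>p\<close> at parameter
    \<open>t\<close>.\<close>
  define x where "x = [:0, cos \<theta>:] - smult (sin \<theta>) p"
  define y where "y = [:0, sin \<theta>:] + smult (cos \<theta>) p"
  have "Phi q \<phi> (unstraighten p \<theta> (t, 0)) =
      poly (pcompose q (smult (cos \<phi>) x + smult (sin \<phi>) y) - (smult (cos \<phi>) y - smult (sin \<phi>) x)) t" for t
    by (simp add: Phi_def unstraighten_def Let_def poly_pcompose x_def y_def algebra_simps)
  then show ?thesis
    using that by blast
qed

text \<open>Along the first graph the second function is a polynomial \<open>r\<close> in the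
  parameter: either \<open>r = 0\<close>, or it has finitely many roots.\<close>

lemma finite_or_subset_graphs:
  "finite {z. Phi p \<theta> z = 0 \<and> Phi q \<phi> z = 0} \<or> {z. Phi p \<theta> z = 0} \<subseteq> {z. Phi q \<phi> z = 0}"
proof -
  obtain r where r: "\<And>t. Phi q \<phi> (unstraighten p \<theta> (t, 0)) = poly r t"
    by (rule Phi_along_graph_poly[of q \<phi> p \<theta>]) blast
  have par: "z = unstraighten p \<theta> (fst (straighten p \<theta> z), 0)" if "Phi p \<theta> z = 0" for z
    using unstraighten_straighten[of p \<theta> z] that by (simp add: straighten_def)
  show ?thesis
  proof (cases "r = 0")
    case True
    then have "Phi q \<phi> z = 0" if "Phi p \<theta> z = 0" for z
      using par[OF that] r by (metis poly_0)
    then show ?thesis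
      by blast
  next
    case False
    have "{z. Phi p \<theta> z = 0 \<and> Phi q \<phi> z = 0} \<subseteq> (\<lambda>t. unstraighten p \<theta> (t, 0)) ` {t. poly r t = 0}"
    proof
      fix z assume "z \<in> {z. Phi p \<theta> z = 0 \<and> Phi q \<phi> z = 0}"
      then have z: "Phi p \<theta> z = 0" "Phi q \<phi> z = 0"
        by auto
      then have "poly r (fst (straighten p \<theta> z)) = 0"
        using par[OF z(1)] r by metis
      then show "z \<in> (\<lambda>t. unstraighten p \<theta> (t, 0)) ` {t. poly r t = 0}"
        using par[OF z(1)] by blast
    qed
    then show ?thesis
      using False poly_roots_finite finite_subset by blast
  qed
qed

theorem theorem4p3:
  fixes k :: nat and p :: "nat \<Rightarrow> real poly" and \<theta> :: "nat \<Rightarrow> real"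
  assumes "\<forall>i<k. \<forall>j<k. i \<noteq> j \<longrightarrow> poly_half_plane (p i) (\<theta> i) \<noteq> poly_half_plane (p j) (\<theta> j)"
  shows "\<exists>F. finite F \<and> pairwise disjnt F \<and> (\<forall>U\<in>F. region_typeII U)
             \<and> \<Union>F = (\<Inter>i\<in>{..<k}. poly_half_plane (p i) (\<theta> i))"
proof (cases "(\<Inter>i\<in>{..<k}. poly_half_plane (p i) (\<theta> i)) = {}")
  case True
  then show ?thesis
    by (intro exI[of _ "{}"]) auto
next
  case False
  \<comment> \<open>A common point is needed because distinct half planes on opposite sides of one
    graph would cross in infinitely many points.\<close>
  then obtain x where x: "\<And>i. i < k \<Longrightarrow> Phi (p i) (\<theta> i) x > 0"
    by (auto simp: poly_half_plane_def)
  \<comment> \<open>The weaker locale comes first: its comparison of half planes is used to prove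
    the finiteness of crossings for the stronger one.\<close>
  interpret fam: straightened_family "{..<k}" "\<lambda>i. Phi (p i) (\<theta> i)"
      "\<lambda>i. unstraighten (p i) (\<theta> i)" "\<lambda>i. straighten (p i) (\<theta> i)"
    by (rule straightened_family_Phi)
  interpret straightened_curves "{..<k}" "\<lambda>i. Phi (p i) (\<theta> i)"
      "\<lambda>i. unstraighten (p i) (\<theta> i)" "\<lambda>i. straighten (p i) (\<theta> i)"
  proof
    fix i j assume ij: "i \<in> {..<k}" "j \<in> {..<k}" "i \<noteq> j"
    then have "{z. Phi (p i) (\<theta> i) z > 0} \<noteq> {z. Phi (p j) (\<theta> j) z > 0}"
      using assms by (auto simp: poly_half_plane_def)
    then have "\<not> {z. Phi (p i) (\<theta> i) z = 0} \<subseteq> {z. Phi (p j) (\<theta> j) z = 0}"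
      using fam.zero_set_subset_imp_half_planes[OF ij(1,2), of x] x ij by blast
    then show "finite {z. Phi (p i) (\<theta> i) z = 0 \<and> Phi (p j) (\<theta> j) z = 0}"
      using finite_or_subset_graphs by blast
  qed
  have "region_typeII U" if U: "U \<in> components X" for U
  proof -
    have "region_typeI (closure U)"
      by (rule region_typeI_closure_component[OF U]) (auto simp: rot_poly_graph_def)
    then show ?thesis
      using interior_closure_component[OF U] by (auto simp: region_typeII_def)
  qed
  moreover have "X = (\<Inter>i\<in>{..<k}. poly_half_plane (p i) (\<theta> i))"
    by (auto simp: X_def poly_half_plane_def)
  ultimately show ?thesis
    using finite_components_X pairwise_disjoint_components[of X] Union_components[of X]
    by (intro exI[of _ "components X"]) (auto simp: disjnt_def pairwise_def)
qed

end
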